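(* Let $k$ be a positive integer, let $M:(k)\times(k)\times(k)\to\mathbb{R}$ be a matrix with nonnegative real entries, let $\beta>0$ be a real number, and let $S\subseteq(k)\times(k)$, such that $$M(l^t_{ij})\leq\beta\quad\text{for all } t\in\{1,2,3\}\text{ and } i,j\in(k),$$ and $$M(l^3_{ij})=\beta\quad\text{for all }(i,j)\in S.$$ Then there exist a positive integer $n$, an ordered partition $\sigma=\{P_1,\ldots,P_k\}$ of $(n)$ with $|P_i|=|P_j|$ for all $i\neq j$, and a partial $S'$-Latin square $L\in T(n,n,n)$, where $$S'=\bigcup_{(i,j)\in S}P_i\times P_j,$$ such that $$\mathrm{supp}(M)=\mathrm{supp}\big(((L\circ_1\sigma)\circ_2\sigma)\circ_3\sigma\big).$$
   Context: For a positive integer $n$, $(n)=\{1,\ldots,n\}$. A 3-indexed $n_1\times n_2\times n_3$-matrix is a function $M:(n_1)\times(n_2)\times(n_3)\to\mathbb{R}$; $T(n_1,n_2,n_3)$ is the set of those whose entries are nonnegative integers. For $X\subseteq(n_1)\times(n_2)\times(n_3)$ write $M(X)=\sum_{x\in X}M(x)$. The support $\mathrm{supp}(M)$ is the set of index triples where $M$ is nonzero. Lines: $l^1_{ab}=\{(x,a,b):x\in(n_1)\}$, $l^2_{ab}=\{(a,x,b):x\in(n_2)\}$, $l^3_{ab}=\{(a,b,x):x\in(n_3)\}$. The line sum of $M$ along a line $l$ is $M(l)$. Partial Latin squares: for $S'\subseteq(n)\times(n)$, a matrix $L\in T(n,n,n)$ is a partial $S'$-Latin square if every line sum of $L$ is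 at most $1$ and $L(l^3_{ij})=1$ for every $(i,j)\in S'$. Quotients: for an ordered partition $\sigma=\{P_1,\ldots,P_r\}$ of $(n_i)$, where $i\in\{1,2,3\}$, the quotient matrix $M\circ_i\sigma$ is obtained by replacing the $i$-th index set $(n_i)$ by $(r)$ and summing over blocks: its value at $(x_1,x_2,x_3)$ (with $x_i\in(r)$) is $M(X)$, where $X$ is the product of the sets $\{x_j\}$ for $j\ne i$ in position $j$ and $P_{x_i}$ in position $i$. For example $(M\circ_1\sigma)(x_1,x_2,x_3)=\sum_{y\in P_{x_1}}M(y,x_2,x_3)$. *)

theory Defs
  imports Complex_Main "HOL-Library.Disjoint_Sets"
begin

text \<open>
  A 3-indexed \<open>n1 \<times> n2 \<times> n3\<close>-matrix is represented by a total function on triples of naturals,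
  of which only the values on \<open>cells n1 n2 n3\<close> (indices counted from 1) matter.
  The sum \<open>M(X)\<close> over a set \<open>X\<close> of cells is \<open>sum M X\<close>.
\<close>

type_synonym mat3 = "nat \<times> nat \<times> nat \<Rightarrow> real"

definition cells :: "nat \<Rightarrow> nat \<Rightarrow> nat \<Rightarrow> (nat \<times> nat \<times> nat) set" where
  "cells n1 n2 n3 = {1..n1} \<times> {1..n2} \<times> {1..n3}"

definition nonneg_int_mats :: "nat \<Rightarrow> nat \<Rightarrow> nat \<Rightarrow> mat3 set" where
  "nonneg_int_mats n1 n2 n3 = {M. \<forall>x\<in>cells n1 n2 n3. M x \<in> \<nat>}"

definition supp3 :: "nat \<Rightarrow> nat \<Rightarrow> nat \<Rightarrow> mat3 \<Rightarrow> (nat \<times> nat \<times> nat) set" where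
  "supp3 n1 n2 n3 M = {x \<in> cells n1 n2 n3. M x \<noteq> 0}"

text \<open>
  The first three arguments of \<open>line\<close> are the dimensions; the direction \<open>t\<close> is only meant to
  range over \<open>{1, 2, 3}\<close>.
\<close>

definition line :: "nat \<Rightarrow> nat \<Rightarrow> nat \<Rightarrow> nat \<Rightarrow> nat \<Rightarrow> nat \<Rightarrow> (nat \<times> nat \<times> nat) set" where
  "line n1 n2 n3 t a b =
     (if t = 1 then {(x, a, b) | x. x \<in> {1..n1}}
      else if t = 2 then {(a, x, b) | x. x \<in> {1..n2}}
      else {(a, b, x) | x. x \<in> {1..n3}})"

definition partial_latin_square :: "nat \<Rightarrow> (nat \<times> nat) set \<Rightarrow> mat3 \<Rightarrow> bool" where
  "partial_latin_square n S L \<longleftrightarrow>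
     S \<subseteq> {1..n} \<times> {1..n} \<and>
     L \<in> nonneg_int_mats n n n \<and>
     (\<forall>t\<in>{1, 2, 3}. \<forall>a\<in>{1..n}. \<forall>b\<in>{1..n}. sum L (line n n n t a b) \<le> 1) \<and>
     (\<forall>(i, j)\<in>S. sum L (line n n n 3 i j) = 1)"

text \<open>\<open>P\<close> enumerates the blocks \<open>P 1, \<dots>, P r\<close>; injectivity makes the \<open>r\<close> blocks pairwise distinct,
  hence disjoint.\<close>

definition ordered_partition :: "nat \<Rightarrow> nat \<Rightarrow> (nat \<Rightarrow> nat set) \<Rightarrow> bool" where
  "ordered_partition n r P \<longleftrightarrow> partition_on {1..n} (P ` {1..r}) \<and> inj_on P {1..r}"

text \<open>\<open>quot3 i P M\<close> is the quotient of \<open>M\<close> by \<open>P\<close> in position \<open>i \<in> {1, 2, 3}\<close>.\<close>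

definition quot3 :: "nat \<Rightarrow> (nat \<Rightarrow> nat set) \<Rightarrow> mat3 \<Rightarrow> mat3" where
  "quot3 i P M = (\<lambda>(x1, x2, x3).
     sum M (if i = 1 then P x1 \<times> {x2} \<times> {x3}
            else if i = 2 then {x1} \<times> P x2 \<times> {x3}
            else {x1} \<times> {x2} \<times> P x3))"

end

theory Submission
  imports Defs "HOL-Analysis.Kronecker_Approximation_Theorem"
begin

text \<open>
  Simultaneous Dirichlet approximation replaces \<open>M\<close> and the bound on its line sums by a matrix \<open>A\<close>
  of natural numbers and a natural number \<open>m\<close>: if the approximation is fine enough, then the errors
  in a line sum add up to less than \<open>1\<close>, so by integrality all the (in)equalities survive, and so
  does the support.

  Regard \<open>A (a, b, c)\<close> as a number of units located at the cell \<open>(a, b, c)\<close>. Every line carries at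
  most \<open>m\<close> units, so the units on a line can be labelled injectively by residues modulo \<open>m\<close>;
  a unit \<open>e\<close> gets a label \<open>\<alpha> e\<close>, \<open>\<beta> e\<close>, \<open>\<gamma> e\<close> for each of the three lines through it. Blow up
  every index \<open>a\<close> to the \<open>m\<^sup>2\<close> indices \<open>(a, u\<^sub>1, u\<^sub>2)\<close> with \<open>u\<^sub>1, u\<^sub>2\<close> residues modulo \<open>m\<close>, and let \<open>L\<close>
  be \<open>1\<close> at \<open>((a, u\<^sub>1, u\<^sub>2), (b, v\<^sub>1, v\<^sub>2), (c, w\<^sub>1, w\<^sub>2))\<close> iff there is a unit \<open>e\<close> at \<open>(a, b, c)\<close> with
  \<open>w\<^sub>1 - u\<^sub>1 = \<beta> e\<close>, \<open>w\<^sub>2 - v\<^sub>1 = \<alpha> e\<close> and \<open>v\<^sub>2 - u\<^sub>2 = \<gamma> e\<close> modulo \<open>m\<close>. Two of the three indices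
  determine one of the labels, hence the unit \<open>e\<close>, and then the third index; and if the labels
  \<open>\<gamma>\<close> on the line of \<open>(a, b)\<close> exhaust all residues, the third index always exists.
\<close>

section \<open>Passage from real to natural entries\<close>

lemma nat_approximation_preserving_sums:
  fixes f :: "'a \<Rightarrow> real" and b :: real
  assumes X: "finite X" and nonneg: "\<And>x. x \<in> X \<Longrightarrow> f x \<ge> 0" and b: "b > 0"
  obtains g :: "'a \<Rightarrow> nat" and m :: nat
  where "m > 0" "\<And>x. x \<in> X \<Longrightarrow> g x = 0 \<longleftrightarrow> f x = 0"
    "\<And>Y. Y \<subseteq> X \<Longrightarrow> sum f Y \<le> b \<Longrightarrow> sum g Y \<le> m"
    "\<And>Y. Y \<subseteq> X \<Longrightarrow> sum f Y = b \<Longrightarrow> sum g Y = m"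
proof -
  define V where "V = insert b (f ` X)"
  have V: "finite V" "\<And>v. v \<in> V \<Longrightarrow> v \<ge> 0" "b \<in> V"
    using X nonneg b by (auto simp: V_def)
  \<comment> \<open>The first bound keeps the total of \<open>card X\<close> errors in entries and
    one error in \<open>b\<close> below 1. The others keep positive values from being rounded to
    0.\<close>
  define \<delta> where "\<delta> = Min (insert (1 / (card X + 1)) {v \<in> V. v > 0})"
  have fin: "finite (insert (1 / (card X + 1)) {v \<in> V. v > 0})" using V by simp
  have "\<delta> \<in> insert (1 / (card X + 1)) {v \<in> V. v > 0}"
    unfolding \<delta>_def by (rule Min_in[OF fin]) simp
  then have \<delta>: "\<delta> > 0" by auto
  have \<delta>_card: "\<delta> \<le> 1 / (card X + 1)" unfolding \<delta>_def by (rule Min_le[OF fin]) simp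
  have \<delta>_le: "\<delta> \<le> v" if "v \<in> V" "v > 0" for v
    unfolding \<delta>_def by (rule Min_le[OF fin]) (use that in simp)
  obtain N :: nat where N: "N > 0" "1 / N < \<delta>"
    using \<delta> real_arch_inverse[of \<delta>] by (auto simp: inverse_eq_divide)
  obtain vs where vs: "set vs = V" using V(1) finite_list by blast
  obtain q p where q: "q > 0" and p: "\<And>i. i < length vs \<Longrightarrow> \<bar>of_int q * vs ! i - of_int (p i)\<bar> < 1 / N"
    using Dirichlet_approx_simult[OF N(1), of "length vs" "\<lambda>i. vs ! i"] by metis
  have "\<exists>z::int. \<bar>of_int q * v - of_int z\<bar> < \<delta>" if "v \<in> V" for v
  proof -
    obtain i where "i < length vs" "vs ! i = v" using \<open>v \<in> V\<close> vs by (metis in_set_conv_nth)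
    then show ?thesis using p[of i] N(2) by (auto intro: less_trans)
  qed
  then obtain r :: "real \<Rightarrow> int" where r: "\<And>v. v \<in> V \<Longrightarrow> \<bar>of_int q * v - of_int (r v)\<bar> < \<delta>"
    by metis
  have "\<delta> \<le> 1" using \<delta>_card by (rule order_trans) simp
  have r_0: "r v = 0" if "v \<in> V" "v = 0" for v
  proof -
    have "\<bar>real_of_int (r v)\<bar> < 1" using r[OF that(1)] that(2) \<open>\<delta> \<le> 1\<close> by simp
    then show ?thesis by linarith
  qed
  \<comment> \<open>Since \<open>q\<close> is at least 1, \<open>q * v\<close> is at least \<delta>,
    while the rounding error is strictly smaller.\<close>
  have r_pos: "r v > 0" if "v \<in> V" "v > 0" for v
  proof -
    have "v \<le> of_int q * v" using q that(2) by simp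
    then have "real_of_int (r v) > 0" using r[OF that(1)] \<delta>_le[OF that] by linarith
    then show ?thesis by simp
  qed
  define g where "g x = nat (r (f x))" for x
  have fV: "f x \<in> V" if "x \<in> X" for x using that by (simp add: V_def)
  have g_int: "real (g x) = of_int (r (f x))" if "x \<in> X" for x
    using r_0[OF fV[OF that]] r_pos[OF fV[OF that]] nonneg[OF that]
    by (cases "f x = 0") (auto simp: g_def)
  have m_int: "real (nat (r b)) = of_int (r b)" using r_pos[OF V(3) b] by simp
  \<comment> \<open>The errors of the entries are only bounded weakly; strictness, also for empty
    \<open>Y\<close>, comes from the error in \<open>b\<close>.\<close>
  have err: "\<bar>(of_int q * sum f Y - of_int q * b) - (real (sum g Y) - real (nat (r b)))\<bar> < 1"
    if Y: "Y \<subseteq> X" for Y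
  proof -
    have "\<bar>of_int q * sum f Y - real (sum g Y)\<bar> = \<bar>\<Sum>x\<in>Y. of_int q * f x - real (g x)\<bar>"
      by (simp add: sum_subtractf sum_distrib_left)
    also have "\<dots> \<le> (\<Sum>x\<in>Y. \<bar>of_int q * f x - real (g x)\<bar>)" by (rule sum_abs)
    also have "\<dots> \<le> (\<Sum>x\<in>Y. \<delta>)"
      using r fV Y g_int by (intro sum_mono) (metis less_imp_le subsetD)
    also have "\<dots> \<le> card X * \<delta>" using card_mono[OF X Y] \<delta> by simp
    finally have "\<bar>of_int q * sum f Y - real (sum g Y)\<bar> \<le> card X * \<delta>" .
    moreover have "card X * \<delta> + \<delta> \<le> 1" using \<delta>_card by (simp add: field_simps)
    ultimately show ?thesis using r[OF V(3)] m_int by linarith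
  qed
  show ?thesis
  proof (rule that[of "nat (r b)" g])
    show "0 < nat (r b)" using r_pos[OF V(3) b] by simp
    show "g x = 0 \<longleftrightarrow> f x = 0" if "x \<in> X" for x
      using r_0[OF fV[OF that]] r_pos[OF fV[OF that]] nonneg[OF that] by (force simp: g_def)
    show "sum g Y \<le> nat (r b)" if "Y \<subseteq> X" "sum f Y \<le> b" for Y
    proof -
      have "of_int q * sum f Y \<le> of_int q * b" using that(2) q by simp
      then have "real (sum g Y) < real (nat (r b)) + 1" using err[OF that(1)] by linarith
      then show ?thesis by linarith
    qed
    show "sum g Y = nat (r b)" if "Y \<subseteq> X" "sum f Y = b" for Y
      using err[OF that(1)] unfolding that(2) by linarith
  qed
qed

text \<open>The units at \<open>j\<close> are the pairs \<open>(j, r)\<close> with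
  \<open>r < A j\<close>, so \<open>sum A J\<close> counts all units. If there are exactly
  \<open>m\<close> of them, an injection into the residues is onto by cardinality.\<close>

lemma exists_labelling:
  fixes A :: "'a \<Rightarrow> nat"
  assumes "finite J" "sum A J \<le> m"
  shows "\<exists>e. inj_on e (SIGMA j:J. {..<A j}) \<and> e ` (SIGMA j:J. {..<A j}) \<subseteq> {..<m} \<and>
    (sum A J = m \<longrightarrow> e ` (SIGMA j:J. {..<A j}) = {..<m})"
proof -
  let ?U = "SIGMA j:J. {..<A j}"
  have fin: "finite ?U" using assms(1) by auto
  have card: "card ?U = sum A J" using assms(1) by simp
  obtain e where e: "e ` ?U \<subseteq> {..<m}" "inj_on e ?U"
    using card_le_inj[OF fin, of "{..<m}"] card assms(2) by auto
  moreover have "e ` ?U = {..<m}" if "sum A J = m"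
    using card_subset_eq[OF _ e(1)] card_image[OF e(2)] card that by simp
  ultimately show ?thesis by blast
qed

section \<open>Line sums and iterated quotients\<close>

lemma sum_line:
  fixes M :: "nat \<times> nat \<times> nat \<Rightarrow> 'a :: comm_monoid_add"
  shows
    "sum M (line n1 n2 n3 1 a b) = (\<Sum>x\<in>{1..n1}. M (x, a, b))"
    "sum M (line n1 n2 n3 2 a b) = (\<Sum>x\<in>{1..n2}. M (a, x, b))"
    "sum M (line n1 n2 n3 3 a b) = (\<Sum>x\<in>{1..n3}. M (a, b, x))"
proof -
  have "line n1 n2 n3 1 a b = (\<lambda>x. (x, a, b)) ` {1..n1}"
    "line n1 n2 n3 2 a b = (\<lambda>x. (a, x, b)) ` {1..n2}"
    "line n1 n2 n3 3 a b = (\<lambda>x. (a, b, x)) ` {1..n3}"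
    by (auto simp: line_def)
  then show "sum M (line n1 n2 n3 1 a b) = (\<Sum>x\<in>{1..n1}. M (x, a, b))"
    "sum M (line n1 n2 n3 2 a b) = (\<Sum>x\<in>{1..n2}. M (a, x, b))"
    "sum M (line n1 n2 n3 3 a b) = (\<Sum>x\<in>{1..n3}. M (a, b, x))"
    by (simp_all add: sum.reindex inj_on_def)
qed

lemma line_subset_cells:
  "t \<in> {1, 2, 3} \<Longrightarrow> i \<in> {1..k} \<Longrightarrow> j \<in> {1..k} \<Longrightarrow> line k k k t i j \<subseteq> cells k k k"
  by (auto simp: line_def cells_def)

text \<open>Unfolding puts the sum of the last quotient outermost; interchanging sums restores the
  order of the product.\<close>

lemma quot3_all: "quot3 3 P (quot3 2 P (quot3 1 P L)) (a, b, c) = sum L (P a \<times> P b \<times> P c)"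
proof -
  have single: "sum f ({x} \<times> B) = (\<Sum>y\<in>B. f (x, y))" "sum g (B \<times> {y}) = (\<Sum>x\<in>B. g (x, y))"
    for f :: "'u \<times> 'v \<Rightarrow> real" and g :: "'v \<times> 'w \<Rightarrow> real" and x y B
    by (simp_all add: sum.cartesian_product')
  have "quot3 3 P (quot3 2 P (quot3 1 P L)) (a, b, c)
      = (\<Sum>z\<in>P c. \<Sum>y\<in>P b. \<Sum>x\<in>P a. L (x, y, z))"
    by (simp add: quot3_def sum.cartesian_product')
  also have "\<dots> = (\<Sum>z\<in>P c. \<Sum>x\<in>P a. \<Sum>y\<in>P b. L (x, y, z))"
    by (intro sum.cong refl sum.swap)
  also have "\<dots> = (\<Sum>x\<in>P a. \<Sum>z\<in>P c. \<Sum>y\<in>P b. L (x, y, z))" by (rule sum.swap)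
  also have "\<dots> = (\<Sum>x\<in>P a. \<Sum>y\<in>P b. \<Sum>z\<in>P c. L (x, y, z))"
    by (intro sum.cong refl sum.swap)
  also have "\<dots> = sum L (P a \<times> P b \<times> P c)" by (simp add: sum.cartesian_product')
  finally show ?thesis .
qed

lemma sum_of_bool_le_1:
  assumes "finite I" "\<And>x y. x \<in> I \<Longrightarrow> y \<in> I \<Longrightarrow> Q x \<Longrightarrow> Q y \<Longrightarrow> x = y"
  shows "(\<Sum>x\<in>I. of_bool (Q x) :: real) \<le> 1"
proof -
  have "card {x \<in> I. Q x} \<le> 1" using assms by (auto simp: card_le_Suc0_iff_eq)
  then show ?thesis using assms(1) by (simp add: sum_of_bool_eq Int_def)
qed

lemma sum_of_bool_eq_1:
  assumes "finite I" "\<exists>!x. x \<in> I \<and> Q x"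
  shows "(\<Sum>x\<in>I. of_bool (Q x) :: real) = 1"
proof -
  obtain x where "{x \<in> I. Q x} = {x}" using assms(2) by blast
  then show ?thesis using assms(1) by (simp add: sum_of_bool_eq Int_def)
qed

section \<open>Cancellation and subtraction of residues\<close>

lemma mod_add_left_cancel:
  fixes u x y m :: nat
  assumes "(u + x) mod m = (u + y) mod m" "x < m" "y < m"
  shows "x = y"
proof -
  \<comment> \<open>Otherwise \<open>m\<close> would divide \<open>y' - x'\<close>, which is
    positive and less than \<open>m\<close>. Equality follows by symmetry.\<close>
  have "y' \<le> x'" if "(u + x') mod m = (u + y') mod m" "y' < m" for x' y'
  proof (rule ccontr)
    assume "\<not> y' \<le> x'"
    then have "m dvd y' - x'" "0 < y' - x'"
      using mod_eq_dvd_iff_nat[of "u + x'" "u + y'" m] that(1) by simp_all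
    then show False using \<open>y' < m\<close> by (auto dest: dvd_imp_le)
  qed
  then show ?thesis using assms by (metis antisym)
qed

lemma mod_add_right_cancel:
  "(x + u) mod m = (y + u) mod m \<Longrightarrow> x < m \<Longrightarrow> y < m \<Longrightarrow> x = (y::nat)"
  by (metis add.commute mod_add_left_cancel)

lemma mod_add_left_solvable:
  assumes "u < m" "v < m"
  obtains x :: nat where "x < m" "(u + x) mod m = v"
proof
  \<comment> \<open>\<open>m - u\<close> represents \<open>-u\<close>; the natural subtraction is
    not truncated because \<open>u < m\<close>.\<close>
  show "(v + (m - u)) mod m < m" using assms by simp
  show "(u + (v + (m - u)) mod m) mod m = v" using assms by (simp add: mod_add_right_eq)
qed

section \<open>Construction of the partial Latin square\<close>

lemma latin_square_of_nat_matrix: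
  fixes A :: "nat \<times> nat \<times> nat \<Rightarrow> nat"
  assumes k: "k > 0" and m: "m > 0" and S: "S \<subseteq> {1..k} \<times> {1..k}"
    and sum1: "\<And>b c. b \<in> {1..k} \<Longrightarrow> c \<in> {1..k} \<Longrightarrow> (\<Sum>a\<in>{1..k}. A (a, b, c)) \<le> m"
    and sum2: "\<And>a c. a \<in> {1..k} \<Longrightarrow> c \<in> {1..k} \<Longrightarrow> (\<Sum>b\<in>{1..k}. A (a, b, c)) \<le> m"
    and sum3: "\<And>a b. a \<in> {1..k} \<Longrightarrow> b \<in> {1..k} \<Longrightarrow> (\<Sum>c\<in>{1..k}. A (a, b, c)) \<le> m"
    and sumS: "\<And>a b. (a, b) \<in> S \<Longrightarrow> (\<Sum>c\<in>{1..k}. A (a, b, c)) = m"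
  shows "\<exists>(n::nat) (P :: nat \<Rightarrow> nat set) (L :: mat3).
           n > 0 \<and>
           ordered_partition n k P \<and>
           (\<forall>i\<in>{1..k}. \<forall>j\<in>{1..k}. i \<noteq> j \<longrightarrow> card (P i) = card (P j)) \<and>
           partial_latin_square n (\<Union>(i, j)\<in>S. P i \<times> P j) L \<and>
           {x \<in> cells k k k. A x \<noteq> 0} = supp3 k k k (quot3 3 P (quot3 2 P (quot3 1 P L)))"
proof -
  let ?K = "{1..k}"
  \<comment> \<open>The range conditions stand under the existential so that choice yields a
    function total in \<open>b\<close> and \<open>c\<close>.\<close>
  have "\<exists>e. b \<in> ?K \<longrightarrow> c \<in> ?K \<longrightarrow> inj_on e (SIGMA a:?K. {..<A (a, b, c)}) \<and>
      e ` (SIGMA a:?K. {..<A (a, b, c)}) \<subseteq> {..<m}" for b c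
    using exists_labelling[OF _ sum1] by (metis finite_atLeastAtMost)
  then obtain \<alpha> where \<alpha>: "\<And>b c. b \<in> ?K \<Longrightarrow> c \<in> ?K \<Longrightarrow> inj_on (\<alpha> b c) (SIGMA a:?K. {..<A (a, b, c)})"
      "\<And>b c. b \<in> ?K \<Longrightarrow> c \<in> ?K \<Longrightarrow> \<alpha> b c ` (SIGMA a:?K. {..<A (a, b, c)}) \<subseteq> {..<m}"
    by metis
  have "\<exists>e. a \<in> ?K \<longrightarrow> c \<in> ?K \<longrightarrow> inj_on e (SIGMA b:?K. {..<A (a, b, c)}) \<and>
      e ` (SIGMA b:?K. {..<A (a, b, c)}) \<subseteq> {..<m}" for a c
    using exists_labelling[OF _ sum2] by (metis finite_atLeastAtMost)
  then obtain \<beta> where \<beta>: "\<And>a c. a \<in> ?K \<Longrightarrow> c \<in> ?K \<Longrightarrow> inj_on (\<beta> a c) (SIGMA b:?K. {..<A (a, b, c)})"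
      "\<And>a c. a \<in> ?K \<Longrightarrow> c \<in> ?K \<Longrightarrow> \<beta> a c ` (SIGMA b:?K. {..<A (a, b, c)}) \<subseteq> {..<m}"
    by metis
  have "\<exists>e. a \<in> ?K \<longrightarrow> b \<in> ?K \<longrightarrow> inj_on e (SIGMA c:?K. {..<A (a, b, c)}) \<and>
      e ` (SIGMA c:?K. {..<A (a, b, c)}) \<subseteq> {..<m} \<and>
      ((a, b) \<in> S \<longrightarrow> e ` (SIGMA c:?K. {..<A (a, b, c)}) = {..<m})" for a b
    using exists_labelling[OF _ sum3] sumS by (metis finite_atLeastAtMost)
  then obtain \<gamma> where \<gamma>: "\<And>a b. a \<in> ?K \<Longrightarrow> b \<in> ?K \<Longrightarrow> inj_on (\<gamma> a b) (SIGMA c:?K. {..<A (a, b, c)})"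
      "\<And>a b. a \<in> ?K \<Longrightarrow> b \<in> ?K \<Longrightarrow> \<gamma> a b ` (SIGMA c:?K. {..<A (a, b, c)}) \<subseteq> {..<m}"
      "\<And>a b. a \<in> ?K \<Longrightarrow> b \<in> ?K \<Longrightarrow> (a, b) \<in> S \<Longrightarrow> \<gamma> a b ` (SIGMA c:?K. {..<A (a, b, c)}) = {..<m}"
    by metis
  have lt: "\<alpha> b c (a, r) < m" "\<beta> a c (b, r) < m" "\<gamma> a b (c, r) < m"
    if "a \<in> ?K" "b \<in> ?K" "c \<in> ?K" "r < A (a, b, c)" for a b c r
    using that \<alpha>(2)[of b c] \<beta>(2)[of a c] \<gamma>(2)[of a b] by (auto simp: image_subset_iff)
  have \<alpha>_inj: "a = a' \<and> r = r'"
    if "\<alpha> b c (a, r) = \<alpha> b c (a', r')" "a \<in> ?K" "a' \<in> ?K" "b \<in> ?K" "c \<in> ?K"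
      "r < A (a, b, c)" "r' < A (a', b, c)" for a a' b c r r'
    using inj_onD[OF \<alpha>(1) that(1)] that by auto
  have \<beta>_inj: "b = b' \<and> r = r'"
    if "\<beta> a c (b, r) = \<beta> a c (b', r')" "a \<in> ?K" "b \<in> ?K" "b' \<in> ?K" "c \<in> ?K"
      "r < A (a, b, c)" "r' < A (a, b', c)" for a b b' c r r'
    using inj_onD[OF \<beta>(1) that(1)] that by auto
  have \<gamma>_inj: "c = c' \<and> r = r'"
    if "\<gamma> a b (c, r) = \<gamma> a b (c', r')" "a \<in> ?K" "b \<in> ?K" "c \<in> ?K" "c' \<in> ?K"
      "r < A (a, b, c)" "r' < A (a, b, c')" for a b c c' r r'
    using inj_onD[OF \<gamma>(1) that(1)] that by auto

  define T where "T = ?K \<times> {..<m} \<times> {..<m}"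
  \<comment> \<open>Each equation links two of the three indices, each pair of indices is linked
    once, and no residue occurs in two equations. This is why every index carries two
    residues.\<close>
  define R where "R = (\<lambda>(a, u1, u2) (b, v1, v2) (c, w1, w2). \<exists>r<A (a, b, c).
      w1 = (u1 + \<beta> a c (b, r)) mod m \<and> w2 = (v1 + \<alpha> b c (a, r)) mod m \<and>
      v2 = (u2 + \<gamma> a b (c, r)) mod m)"
  \<comment> \<open>The \<gamma> equation identifies the unit; the other two then give the residues
    of \<open>z\<close> explicitly.\<close>
  have uniq3: "z = z'" if xyz: "x \<in> T" "y \<in> T" "z \<in> T" "z' \<in> T" and R: "R x y z" "R x y z'"
    for x y z z'
  proof -
    obtain a u1 u2 b v1 v2 c w1 w2 c' w1' w2'
      where eqs: "x = (a, u1, u2)" "y = (b, v1, v2)" "z = (c, w1, w2)" "z' = (c', w1', w2')"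
      by (metis prod_cases3)
    obtain r r' where r: "r < A (a, b, c)" "r' < A (a, b, c')"
      and 1: "w1 = (u1 + \<beta> a c (b, r)) mod m" "w2 = (v1 + \<alpha> b c (a, r)) mod m"
        "v2 = (u2 + \<gamma> a b (c, r)) mod m"
      and 2: "w1' = (u1 + \<beta> a c' (b, r')) mod m" "w2' = (v1 + \<alpha> b c' (a, r')) mod m"
        "v2 = (u2 + \<gamma> a b (c', r')) mod m"
      using R unfolding eqs R_def by auto
    have in_K: "a \<in> ?K" "b \<in> ?K" "c \<in> ?K" "c' \<in> ?K" using xyz unfolding eqs T_def by auto
    have "\<gamma> a b (c, r) = \<gamma> a b (c', r')"
      using mod_add_left_cancel 1(3) 2(3) lt(3) in_K r by metis
    then have "c = c' \<and> r = r'" using \<gamma>_inj in_K r by blast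
    then show ?thesis using 1 2 eqs by simp
  qed
  \<comment> \<open>Here the \<beta> equation identifies the unit, and \<open>v1\<close> is
    recovered from \<open>w2\<close> by cancelling the \<alpha> label.\<close>
  have uniq2: "y = y'" if xyz: "x \<in> T" "y \<in> T" "y' \<in> T" "z \<in> T" and R: "R x y z" "R x y' z"
    for x y y' z
  proof -
    obtain a u1 u2 b v1 v2 c w1 w2 b' v1' v2'
      where eqs: "x = (a, u1, u2)" "y = (b, v1, v2)" "z = (c, w1, w2)" "y' = (b', v1', v2')"
      by (metis prod_cases3)
    obtain r r' where r: "r < A (a, b, c)" "r' < A (a, b', c)"
      and 1: "w1 = (u1 + \<beta> a c (b, r)) mod m" "w2 = (v1 + \<alpha> b c (a, r)) mod m"
        "v2 = (u2 + \<gamma> a b (c, r)) mod m"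
      and 2: "w1 = (u1 + \<beta> a c (b', r')) mod m" "w2 = (v1' + \<alpha> b' c (a, r')) mod m"
        "v2' = (u2 + \<gamma> a b' (c, r')) mod m"
      using R unfolding eqs R_def by auto
    have in_K: "a \<in> ?K" "b \<in> ?K" "b' \<in> ?K" "c \<in> ?K" and v: "v1 < m" "v1' < m"
      using xyz unfolding eqs T_def by auto
    have "\<beta> a c (b, r) = \<beta> a c (b', r')"
      using mod_add_left_cancel 1(1) 2(1) lt(2) in_K r by metis
    then have *: "b = b' \<and> r = r'" using \<beta>_inj in_K r by blast
    then have "v1 = v1'" using mod_add_right_cancel 1(2) 2(2) v by metis
    then show ?thesis using * 1 2 eqs by simp
  qed
  \<comment> \<open>Here the \<alpha> equation identifies the unit, and both residues of
    \<open>x\<close> are recovered by cancellation.\<close>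
  have uniq1: "x = x'" if xyz: "x \<in> T" "x' \<in> T" "y \<in> T" "z \<in> T" and R: "R x y z" "R x' y z"
    for x x' y z
  proof -
    obtain a u1 u2 b v1 v2 c w1 w2 a' u1' u2'
      where eqs: "x = (a, u1, u2)" "y = (b, v1, v2)" "z = (c, w1, w2)" "x' = (a', u1', u2')"
      by (metis prod_cases3)
    obtain r r' where r: "r < A (a, b, c)" "r' < A (a', b, c)"
      and 1: "w1 = (u1 + \<beta> a c (b, r)) mod m" "w2 = (v1 + \<alpha> b c (a, r)) mod m"
        "v2 = (u2 + \<gamma> a b (c, r)) mod m"
      and 2: "w1 = (u1' + \<beta> a' c (b, r')) mod m" "w2 = (v1 + \<alpha> b c (a', r')) mod m"
        "v2 = (u2' + \<gamma> a' b (c, r')) mod m"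
      using R unfolding eqs R_def by auto
    have in_K: "a \<in> ?K" "b \<in> ?K" "a' \<in> ?K" "c \<in> ?K"
      and u: "u1 < m" "u1' < m" "u2 < m" "u2' < m"
      using xyz unfolding eqs T_def by auto
    have "\<alpha> b c (a, r) = \<alpha> b c (a', r')"
      using mod_add_left_cancel 1(2) 2(2) lt(1) in_K r by metis
    then have *: "a = a' \<and> r = r'" using \<alpha>_inj in_K r by blast
    then have "u1 = u1'" "u2 = u2'" using mod_add_right_cancel 1 2 u by metis+
    then show ?thesis using * eqs by simp
  qed
  have exists3: "\<exists>z\<in>T. R x y z" if xy: "x \<in> T" "y \<in> T" and "(fst x, fst y) \<in> S" for x y
  proof -
    obtain a u1 u2 b v1 v2 where eqs: "x = (a, u1, u2)" "y = (b, v1, v2)" by (metis prod_cases3)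
    have ab: "a \<in> ?K" "b \<in> ?K" "u2 < m" "v2 < m" using xy unfolding eqs T_def by auto
    \<comment> \<open>\<open>g\<close> is the label \<open>v2 - u2\<close> modulo \<open>m\<close>.
      Some unit on the line has it, as the line sum is exactly \<open>m\<close>; this unit supplies
      \<open>c\<close> and both residues of \<open>z\<close>.\<close>
    obtain g where g: "g < m" "(u2 + g) mod m = v2" using mod_add_left_solvable ab(3,4) .
    have "g \<in> \<gamma> a b ` (SIGMA c:?K. {..<A (a, b, c)})"
      using \<gamma>(3)[OF ab(1,2)] that(3) g(1) eqs by simp
    then obtain c r where "c \<in> ?K" "r < A (a, b, c)" "g = \<gamma> a b (c, r)" by auto
    then have "(c, (u1 + \<beta> a c (b, r)) mod m, (v1 + \<alpha> b c (a, r)) mod m) \<in> T"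
      "R x y (c, (u1 + \<beta> a c (b, r)) mod m, (v1 + \<alpha> b c (a, r)) mod m)"
      using m g(2) unfolding T_def R_def eqs by auto
    then show ?thesis by blast
  qed

  define n where "n = k * (m * m)"
  \<comment> \<open>Any numbering \<open>h\<close> of \<open>T\<close> works: blocks and entries are
    pulled back along it.\<close>
  have "card {1..n} = card T" by (simp add: T_def n_def)
  then obtain h where h: "bij_betw h {1..n} T"
    using finite_same_card_bij[of "{1..n}" T] by (auto simp: T_def)
  have h_in: "h x \<in> T" if "x \<in> {1..n}" for x using h that by (rule bij_betwE[rule_format])
  have h_inj: "x = y" if "h x = h y" "x \<in> {1..n}" "y \<in> {1..n}" for x y
    using inj_onD[OF bij_betw_imp_inj_on[OF h]] that by blast
  have h_surj: "\<exists>x\<in>{1..n}. h x = z" if "z \<in> T" for z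
    using that bij_betw_imp_surj_on[OF h] by (metis imageE)
  define P where "P i = {x \<in> {1..n}. fst (h x) = i}" for i
  define L :: mat3 where "L = (\<lambda>(x, y, z). of_bool (R (h x) (h y) (h z)))"

  have card_P: "card (P i) = m * m" if "i \<in> ?K" for i
  proof -
    have "h ` P i = {i} \<times> {..<m} \<times> {..<m}"
    proof (intro equalityI subsetI)
      fix z assume "z \<in> h ` P i"
      then show "z \<in> {i} \<times> {..<m} \<times> {..<m}" using h_in by (force simp: P_def T_def)
    next
      fix z assume z: "z \<in> {i} \<times> {..<m} \<times> {..<m}"
      then have "z \<in> T" using that by (auto simp: T_def)
      then obtain x where "x \<in> {1..n}" "h x = z" using h_surj by blast
      then show "z \<in> h ` P i" using z by (auto simp: P_def)
    qed
    moreover have "inj_on h (P i)" using h_inj by (auto simp: inj_on_def P_def)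
    ultimately show ?thesis using card_image[of h "P i"] by (simp add: card_cartesian_product)
  qed
  have nonempty: "P i \<noteq> {}" if "i \<in> ?K" for i
    using card_P[OF that] m by auto
  have "ordered_partition n k P"
    unfolding ordered_partition_def partition_on_def
  proof (intro conjI)
    have "fst (h x) \<in> ?K" if "x \<in> {1..n}" for x using h_in[OF that] by (auto simp: T_def)
    then show "\<Union> (P ` ?K) = {1..n}" by (auto simp: P_def)
    show "disjoint (P ` ?K)" by (auto simp: disjoint_def P_def)
    show "{} \<notin> P ` ?K" using nonempty by (metis imageE)
    show "inj_on P ?K"
    proof (rule inj_onI)
      fix i j assume "i \<in> ?K" "P i = P j"
      then obtain x where "x \<in> P i" "x \<in> P j" using nonempty by blast
      then show "i = j" by (simp add: P_def)
    qed
  qed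
  moreover have "partial_latin_square n (\<Union>(i, j)\<in>S. P i \<times> P j) L"
    unfolding partial_latin_square_def
  proof (intro conjI ballI)
    show "(\<Union>(i, j)\<in>S. P i \<times> P j) \<subseteq> {1..n} \<times> {1..n}" by (auto simp: P_def)
    show "L \<in> nonneg_int_mats n n n" by (auto simp: nonneg_int_mats_def L_def of_bool_def)
  next
    fix t a b :: nat assume t: "t \<in> {1, 2, 3}" and ab: "a \<in> {1..n}" "b \<in> {1..n}"
    have "sum L (line n n n 1 a b) \<le> 1" unfolding sum_line L_def prod.case
      by (rule sum_of_bool_le_1) (use uniq1 h_in h_inj ab in \<open>blast+\<close>)
    moreover have "sum L (line n n n 2 a b) \<le> 1" unfolding sum_line L_def prod.case
      by (rule sum_of_bool_le_1) (use uniq2 h_in h_inj ab in \<open>blast+\<close>)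
    moreover have "sum L (line n n n 3 a b) \<le> 1" unfolding sum_line L_def prod.case
      by (rule sum_of_bool_le_1) (use uniq3 h_in h_inj ab in \<open>blast+\<close>)
    ultimately show "sum L (line n n n t a b) \<le> 1" using t by auto
  next
    fix xy assume "xy \<in> (\<Union>(i, j)\<in>S. P i \<times> P j)"
    then obtain x y where xy: "xy = (x, y)" "x \<in> {1..n}" "y \<in> {1..n}" "(fst (h x), fst (h y)) \<in> S"
      by (auto simp: P_def)
    obtain z where z: "z \<in> {1..n}" "R (h x) (h y) (h z)"
      using exists3[OF h_in h_in] xy(2-4) h_surj by metis
    have "\<exists>!z. z \<in> {1..n} \<and> R (h x) (h y) (h z)"
      using z uniq3[OF h_in h_in h_in h_in] xy(2,3) h_inj by blast
    then have "sum L (line n n n 3 x y) = 1" unfolding sum_line L_def prod.case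
      by (intro sum_of_bool_eq_1) auto
    then show "case xy of (i, j) \<Rightarrow> sum L (line n n n 3 i j) = 1" using xy(1) by simp
  qed
  moreover have "A (a, b, c) \<noteq> 0 \<longleftrightarrow> quot3 3 P (quot3 2 P (quot3 1 P L)) (a, b, c) \<noteq> 0"
    if abc: "a \<in> ?K" "b \<in> ?K" "c \<in> ?K" for a b c
  proof -
    have "finite (P i)" for i by (simp add: P_def)
    \<comment> \<open>The entries of \<open>L\<close> are 0 or 1, so nothing cancels in the
      sum.\<close>
    then have "sum L (P a \<times> P b \<times> P c) \<noteq> 0 \<longleftrightarrow> (\<exists>x\<in>P a. \<exists>y\<in>P b. \<exists>z\<in>P c. R (h x) (h y) (h z))"
      by (subst sum_nonneg_eq_0_iff) (auto simp: L_def)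
    also have "\<dots> \<longleftrightarrow> A (a, b, c) \<noteq> 0"
    proof
      assume "\<exists>x\<in>P a. \<exists>y\<in>P b. \<exists>z\<in>P c. R (h x) (h y) (h z)"
      then show "A (a, b, c) \<noteq> 0" by (auto simp: P_def R_def case_prod_beta)
    next
      assume "A (a, b, c) \<noteq> 0"
      then have r: "0 < A (a, b, c)" by simp
      \<comment> \<open>Unit number 0 at the cell is used. With \<open>u1 = u2 = v1 = 0\<close>, the
        equations force the other residues to be its labels.\<close>
      let ?x = "(a, 0, 0)" and ?y = "(b, 0, \<gamma> a b (c, 0))" and ?z = "(c, \<beta> a c (b, 0), \<alpha> b c (a, 0))"
      have "?x \<in> T" "?y \<in> T" "?z \<in> T" using lt[OF abc r] m abc by (auto simp: T_def)
      then obtain x y z where xyz: "x \<in> {1..n}" "y \<in> {1..n}" "z \<in> {1..n}"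
          "h x = ?x" "h y = ?y" "h z = ?z"
        using h_surj by metis
      moreover have "R ?x ?y ?z" using lt[OF abc r] r by (auto simp: R_def intro!: exI[of _ 0])
      ultimately show "\<exists>x\<in>P a. \<exists>y\<in>P b. \<exists>z\<in>P c. R (h x) (h y) (h z)"
        unfolding P_def by force
    qed
    finally show ?thesis unfolding quot3_all by blast
  qed
  then have "{x \<in> cells k k k. A x \<noteq> 0} = supp3 k k k (quot3 3 P (quot3 2 P (quot3 1 P L)))"
    unfolding supp3_def cells_def by blast
  moreover have "n > 0" using k m by (simp add: n_def)
  ultimately show ?thesis using card_P by (intro exI[of _ n] exI[of _ P] exI[of _ L]) simp
qed

theorem theorem3:
  fixes k :: nat and M :: mat3 and \<beta> :: real and S :: "(nat \<times> nat) set"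
  assumes "k > 0"
    and "\<forall>x\<in>cells k k k. M x \<ge> 0"
    and "\<beta> > 0"
    and "S \<subseteq> {1..k} \<times> {1..k}"
    and "\<forall>t\<in>{1, 2, 3}. \<forall>i\<in>{1..k}. \<forall>j\<in>{1..k}. sum M (line k k k t i j) \<le> \<beta>"
    and "\<forall>(i, j)\<in>S. sum M (line k k k 3 i j) = \<beta>"
  shows "\<exists>(n::nat) (P :: nat \<Rightarrow> nat set) (L :: mat3).
           n > 0 \<and>
           ordered_partition n k P \<and>
           (\<forall>i\<in>{1..k}. \<forall>j\<in>{1..k}. i \<noteq> j \<longrightarrow> card (P i) = card (P j)) \<and>
           partial_latin_square n (\<Union>(i, j)\<in>S. P i \<times> P j) L \<and>
           supp3 k k k M = supp3 k k k (quot3 3 P (quot3 2 P (quot3 1 P L)))"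
proof -
  have "finite (cells k k k)" by (simp add: cells_def)
  then obtain A :: "nat \<times> nat \<times> nat \<Rightarrow> nat" and m :: nat
    where m: "m > 0" and supp: "\<And>x. x \<in> cells k k k \<Longrightarrow> A x = 0 \<longleftrightarrow> M x = 0"
      and le: "\<And>Y. Y \<subseteq> cells k k k \<Longrightarrow> sum M Y \<le> \<beta> \<Longrightarrow> sum A Y \<le> m"
      and eq: "\<And>Y. Y \<subseteq> cells k k k \<Longrightarrow> sum M Y = \<beta> \<Longrightarrow> sum A Y = m"
    using nat_approximation_preserving_sums[of "cells k k k" M \<beta>] assms(2,3) by metis
  \<comment> \<open>The approximation applies to lines because they are sets of cells.\<close>
  have line_le: "sum A (line k k k t i j) \<le> m"
    if "t \<in> {1, 2, 3}" "i \<in> {1..k}" "j \<in> {1..k}" for t i j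
    using le[OF line_subset_cells[OF that]] assms(5) that by blast
  have line_eq: "sum A (line k k k 3 i j) = m" if "(i, j) \<in> S" for i j
  proof (rule eq[OF line_subset_cells])
    show "i \<in> {1..k}" "j \<in> {1..k}" using that assms(4) by auto
    show "sum M (line k k k 3 i j) = \<beta>" using that assms(6) by auto
  qed simp
  have "{x \<in> cells k k k. A x \<noteq> 0} = supp3 k k k M"
    unfolding supp3_def by (rule Collect_cong) (simp add: supp cong: conj_cong)
  moreover note latin_square_of_nat_matrix[OF assms(1) m assms(4), of A,
      OF line_le[of 1, unfolded sum_line] line_le[of 2, unfolded sum_line]
        line_le[of 3, unfolded sum_line] line_eq[unfolded sum_line]]
  ultimately show ?thesis by simp
qed

end
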